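(* Let $\varphi$ be an $\mathrm{LTL}$ formula over a finite alphabet $\Sigma$. Then there exists a $\mathsf{BE}$ formula $\varphi_{\mathrm{HS}}$ over $\Sigma$ such that $L_{act}(\varphi_{\mathrm{HS}})=L_{act}(\varphi)$.
   Context: $\Sigma^+$ denotes the set of non-empty finite words over $\Sigma$. For $w=w(0)\cdots w(n)$, $\mathrm{Pref}(w)=\{w(0)\cdots w(i)\mid 0\le i\le n-1\}$ and $\mathrm{Suff}(w)=\{w(i)\cdots w(n)\mid 1\le i\le n\}$ (proper prefixes and suffixes). $\mathrm{LTL}$ over $\Sigma$ (action-based semantics over finite words): formulas $\varphi::=\top\mid a\mid\neg\varphi\mid\varphi\wedge\varphi\mid\mathsf X\varphi\mid\varphi\mathsf U\varphi$ with $a\in\Sigma$; for $w\in\Sigma^+$ and $0\le i<|w|$: $w,i\models a$ iff $w(i)=a$; $w,i\models\mathsf X\varphi$ iff $i+1<|w|$ and $w,i+1\models\varphi$; $w,i\models\varphi_1\mathsf U\varphi_2$ iff there is $i\le j<|w|$ with $w,j\models\varphi_2$ and $w,k\models\varphi_1$ for all $i\le k<j$; Booleans as usual. $L_{act}(\varphi)=\{w\in\Sigma^+\mid w,0\models\varphi\}$. $\mathsf{BE}$ formulas over $\Sigma$: $\psi::=a\mid\neg\psi\mid\psi\wedge\psi\mid\langle B\rangle\psi\mid\langle E\rangle\psi$ with $a\in\Sigma$, with languages $L_{act}(a)=a^+$, $L_{act}(\neg\psi)=\Sigma^+\setminus L_{act}(\psi)$, $L_{act}(\psi_1\wedge\psi_2)=L_{act}(\psi_1)\cap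 L_{act}(\psi_2)$, $L_{act}(\langle B\rangle\psi)=\{w\in\Sigma^+\mid\mathrm{Pref}(w)\cap L_{act}(\psi)\neq\emptyset\}$, $L_{act}(\langle E\rangle\psi)=\{w\in\Sigma^+\mid\mathrm{Suff}(w)\cap L_{act}(\psi)\neq\emptyset\}$. *)

theory Defs
  imports Main
begin

text \<open>Finite words over the alphabet 'a are lists; only non-empty lists are words (Sigma^+).
  Positions are 0-based; w ! i is w(i).\<close>

definition words :: "'a list set" where
  "words = {w. w \<noteq> []}"

definition Pref :: "'a list \<Rightarrow> 'a list set" where
  "Pref w = {take (i + 1) w | i. i + 1 \<le> length w - 1}"

definition Suff :: "'a list \<Rightarrow> 'a list set" where
  "Suff w = {drop i w | i. 1 \<le> i \<and> i \<le> length w - 1}"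

datatype 'a ltl =
    LTrue
  | LAct 'a
  | LNot "'a ltl"
  | LAnd "'a ltl" "'a ltl"
  | LNext "'a ltl"
  | LUntil "'a ltl" "'a ltl"

fun ltl_sat :: "'a list \<Rightarrow> nat \<Rightarrow> 'a ltl \<Rightarrow> bool" where
  "ltl_sat w i LTrue = True"
| "ltl_sat w i (LAct a) = (w ! i = a)"
| "ltl_sat w i (LNot \<phi>) = (\<not> ltl_sat w i \<phi>)"
| "ltl_sat w i (LAnd \<phi> \<psi>) = (ltl_sat w i \<phi> \<and> ltl_sat w i \<psi>)"
| "ltl_sat w i (LNext \<phi>) = (i + 1 < length w \<and> ltl_sat w (i + 1) \<phi>)"
| "ltl_sat w i (LUntil \<phi> \<psi>) =
     (\<exists>j. i \<le> j \<and> j < length w \<and> ltl_sat w j \<psi> \<and> (\<forall>k. i \<le> k \<and> k < j \<longrightarrow> ltl_sat w k \<phi>))"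

definition L_ltl :: "'a ltl \<Rightarrow> 'a list set" where
  "L_ltl \<phi> = {w \<in> words. ltl_sat w 0 \<phi>}"

datatype 'a be =
    BAct 'a
  | BNot "'a be"
  | BAnd "'a be" "'a be"
  | BB "'a be"
  | BE "'a be"

fun L_be :: "'a be \<Rightarrow> 'a list set" where
  "L_be (BAct a) = {w \<in> words. \<forall>i < length w. w ! i = a}"
| "L_be (BNot \<psi>) = words - L_be \<psi>"
| "L_be (BAnd \<psi>1 \<psi>2) = L_be \<psi>1 \<inter> L_be \<psi>2"
| "L_be (BB \<psi>) = {w \<in> words. Pref w \<inter> L_be \<psi> \<noteq> {}}"
| "L_be (BE \<psi>) = {w \<in> words. Suff w \<inter> L_be \<psi> \<noteq> {}}"

end

theory Submission
  imports Defs "HOL-Library.FuncSet"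
begin

text \<open>Read from right to left, a word drives a deterministic automaton whose states are the sets of
  subformulas of the given LTL formula; this automaton is counter-free. Following Wilke, every language
  of a counter-free automaton is shown to be definable by induction on the number of states and then
  on the size of the alphabet. If every letter permutes the states, then by counter-freeness every
  letter acts as the identity. Otherwise some letter \<open>b\<close> maps the state set \<open>Q\<close> to a proper subset
  \<open>b ` Q\<close>. Cutting a word at the occurrences of \<open>b\<close> leaves factors over a smaller alphabet, and between
  the first and the last \<open>b\<close> a word over the alphabet of functions induced by the factors on the
  smaller state set \<open>b ` Q\<close>. The letter \<open>b\<close> marks the cutting points, so prefixes and suffixes of the
  word of blocks are visible as prefixes and suffixes of the original word that end or start with \<open>b\<close>.\<close>

section \<open>Definable predicates\<close>

text \<open>Correctness is asked only on words over \<open>A\<close>, since the later induction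
  shrinks and replaces the alphabet while the formula keeps its type. The empty word lies in no
  \<open>BE\<close> language, so the value \<open>P []\<close> is left free.\<close>

definition definable :: "'a set \<Rightarrow> ('a list \<Rightarrow> bool) \<Rightarrow> bool" where
  "definable A P \<longleftrightarrow> (\<exists>\<psi>. \<forall>w. w \<noteq> [] \<longrightarrow> set w \<subseteq> A \<longrightarrow> (w \<in> L_be \<psi> \<longleftrightarrow> P w))"

section \<open>Languages of \<open>BE\<close> formulas in terms of splittings of words\<close>

lemma L_be_nonempty: "w \<in> L_be \<psi> \<Longrightarrow> w \<noteq> []"
  by (induction \<psi> arbitrary: w) (auto simp: words_def)

lemma Pref_iff: "u \<in> Pref w \<longleftrightarrow> u \<noteq> [] \<and> (\<exists>v. v \<noteq> [] \<and> w = u @ v)"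
proof
  assume "u \<in> Pref w"
  then obtain i where "u = take (i + 1) w" "i + 1 \<le> length w - 1"
    by (auto simp: Pref_def)
  then show "u \<noteq> [] \<and> (\<exists>v. v \<noteq> [] \<and> w = u @ v)"
    by (intro conjI exI[of _ "drop (i + 1) w"]) auto
next
  assume "u \<noteq> [] \<and> (\<exists>v. v \<noteq> [] \<and> w = u @ v)"
  then obtain v where "u \<noteq> []" "v \<noteq> []" "w = u @ v" by blast
  then show "u \<in> Pref w"
    unfolding Pref_def
    by (intro CollectI exI[of _ "length u - 1"]) (cases u; cases v; auto)
qed

lemma Suff_iff: "v \<in> Suff w \<longleftrightarrow> v \<noteq> [] \<and> (\<exists>u. u \<noteq> [] \<and> w = u @ v)"
proof
  assume "v \<in> Suff w"
  then obtain i where "v = drop i w" "1 \<le> i" "i \<le> length w - 1"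
    by (auto simp: Suff_def)
  then show "v \<noteq> [] \<and> (\<exists>u. u \<noteq> [] \<and> w = u @ v)"
    by (intro conjI exI[of _ "take i w"]) auto
next
  assume "v \<noteq> [] \<and> (\<exists>u. u \<noteq> [] \<and> w = u @ v)"
  then obtain u where "u \<noteq> []" "v \<noteq> []" "w = u @ v" by blast
  then show "v \<in> Suff w"
    unfolding Suff_def
    by (intro CollectI exI[of _ "length u"]) (cases u; cases v; auto)
qed

lemma L_be_BAct: "w \<in> L_be (BAct a) \<longleftrightarrow> w \<noteq> [] \<and> (\<forall>x\<in>set w. x = a)"
  by (auto simp: words_def all_set_conv_all_nth)

lemma L_be_BNot: "w \<in> L_be (BNot \<psi>) \<longleftrightarrow> w \<noteq> [] \<and> w \<notin> L_be \<psi>"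
  by (auto simp: words_def)

lemma L_be_BB: "w \<in> L_be (BB \<psi>) \<longleftrightarrow> (\<exists>u v. w = u @ v \<and> u \<noteq> [] \<and> v \<noteq> [] \<and> u \<in> L_be \<psi>)"
proof -
  have "w \<in> L_be (BB \<psi>) \<longleftrightarrow> w \<noteq> [] \<and> (\<exists>u. u \<in> Pref w \<and> u \<in> L_be \<psi>)"
    by (auto simp: words_def)
  then show ?thesis unfolding Pref_iff by auto
qed

lemma L_be_BE: "w \<in> L_be (BE \<psi>) \<longleftrightarrow> (\<exists>u v. w = u @ v \<and> u \<noteq> [] \<and> v \<noteq> [] \<and> v \<in> L_be \<psi>)"
proof -
  have "w \<in> L_be (BE \<psi>) \<longleftrightarrow> w \<noteq> [] \<and> (\<exists>u. u \<in> Suff w \<and> u \<in> L_be \<psi>)"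
    by (auto simp: words_def)
  then show ?thesis unfolding Suff_iff by auto
qed

lemmas L_be_iff = L_be_BAct L_be_BNot L_be_BB L_be_BE L_be.simps(3)

declare L_be.simps [simp del]

section \<open>Boolean closure\<close>

lemma definable_L_be: "definable A (\<lambda>w. w \<in> L_be \<psi>)"
  unfolding definable_def by blast

lemma definable_cong:
  assumes "definable A P" "\<And>w. w \<noteq> [] \<Longrightarrow> set w \<subseteq> A \<Longrightarrow> P w \<longleftrightarrow> R w"
  shows "definable A R"
  using assms unfolding definable_def by simp

lemma definable_not: "definable A P \<Longrightarrow> definable A (\<lambda>w. \<not> P w)"
  unfolding definable_def by (metis L_be_BNot)

lemma definable_and: "definable A P \<Longrightarrow> definable A R \<Longrightarrow> definable A (\<lambda>w. P w \<and> R w)"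
  unfolding definable_def by (metis L_be.simps(3) Int_iff)

lemma definable_or: "definable A P \<Longrightarrow> definable A R \<Longrightarrow> definable A (\<lambda>w. P w \<or> R w)"
  by (rule definable_cong[OF definable_not[OF definable_and[OF definable_not definable_not]]]) auto

lemma definable_const: "definable A (\<lambda>w. c)"
proof -
  \<comment> \<open>\<open>BE\<close> has no truth constant; falsity is a formula together with its
    negation, and \<open>undefined\<close> only supplies some letter.\<close>
  let ?P = "\<lambda>w. w \<in> L_be (BAct undefined)"
  have "definable A (\<lambda>w. ?P w \<and> \<not> ?P w)"
    by (intro definable_and definable_not definable_L_be)
  then have "definable A (\<lambda>w. False)" by simp
  then show ?thesis using definable_not[of A "\<lambda>w. False"] by (cases c) auto
qed

lemma definable_bex:
  assumes "finite I" "\<And>i. i \<in> I \<Longrightarrow> definable A (P i)"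
  shows "definable A (\<lambda>w. \<exists>i\<in>I. P i w)"
  using assms
proof (induction I rule: finite_induct)
  case empty
  then show ?case by (simp add: definable_const)
next
  case (insert i I)
  then show ?case using definable_or[of A "P i" "\<lambda>w. \<exists>i\<in>I. P i w"] by simp
qed

section \<open>Prefixes, suffixes and reversal\<close>

lemma definable_prefix:
  assumes "definable A P"
  shows "definable A (\<lambda>w. \<exists>u v. w = u @ v \<and> u \<noteq> [] \<and> v \<noteq> [] \<and> P u)"
proof -
  obtain \<psi> where "\<forall>w. w \<noteq> [] \<longrightarrow> set w \<subseteq> A \<longrightarrow> (w \<in> L_be \<psi> \<longleftrightarrow> P w)"
    using assms unfolding definable_def by blast
  then have "w = u @ v \<Longrightarrow> u \<noteq> [] \<Longrightarrow> set w \<subseteq> A \<Longrightarrow> u \<in> L_be \<psi> \<longleftrightarrow> P u" for u v w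
    by simp
  then have "\<forall>w. w \<noteq> [] \<longrightarrow> set w \<subseteq> A \<longrightarrow> (w \<in> L_be (BB \<psi>) \<longleftrightarrow>
      (\<exists>u v. w = u @ v \<and> u \<noteq> [] \<and> v \<noteq> [] \<and> P u))"
    unfolding L_be_BB by blast
  then show ?thesis unfolding definable_def by blast
qed

lemma definable_prefix_eq:
  assumes "definable A P"
  shows "definable A (\<lambda>w. \<exists>u v. w = u @ v \<and> u \<noteq> [] \<and> P u)"
  by (rule definable_cong[OF definable_or[OF assms definable_prefix[OF assms]]])
    (metis append.right_neutral)

text \<open>Reversal exchanges proper prefixes and suffixes and preserves powers of a letter, so
  closure properties shown for one end of a word can be carried over to the other.\<close>

fun mirror :: "'a be \<Rightarrow> 'a be" where
  "mirror (BAct a) = BAct a"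
| "mirror (BNot \<psi>) = BNot (mirror \<psi>)"
| "mirror (BAnd \<psi> \<chi>) = BAnd (mirror \<psi>) (mirror \<chi>)"
| "mirror (BB \<psi>) = BE (mirror \<psi>)"
| "mirror (BE \<psi>) = BB (mirror \<psi>)"

lemma append_eq_rev_iff: "rev w = u @ v \<longleftrightarrow> w = rev v @ rev u"
  by (metis rev_append rev_rev_ident)

lemma L_be_mirror: "w \<in> L_be (mirror \<psi>) \<longleftrightarrow> rev w \<in> L_be \<psi>"
proof (induction \<psi> arbitrary: w)
  case (BB \<psi>)
  show ?case
    unfolding mirror.simps L_be_BE L_be_BB BB append_eq_rev_iff
    by (metis rev_is_Nil_conv rev_rev_ident)
next
  case (BE \<psi>)
  show ?case
    unfolding mirror.simps L_be_BE L_be_BB BE append_eq_rev_iff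
    by (metis rev_is_Nil_conv rev_rev_ident)
qed (simp_all add: L_be_iff)

lemma definable_rev:
  assumes "definable A P"
  shows "definable A (\<lambda>w. P (rev w))"
proof -
  obtain \<psi> where "\<forall>w. w \<noteq> [] \<longrightarrow> set w \<subseteq> A \<longrightarrow> (w \<in> L_be \<psi> \<longleftrightarrow> P w)"
    using assms unfolding definable_def by blast
  then have "\<forall>w. w \<noteq> [] \<longrightarrow> set w \<subseteq> A \<longrightarrow> (w \<in> L_be (mirror \<psi>) \<longleftrightarrow> P (rev w))"
    unfolding L_be_mirror by auto
  then show ?thesis unfolding definable_def by blast
qed

lemma definable_suffix:
  assumes "definable A P"
  shows "definable A (\<lambda>w. \<exists>u v. w = u @ v \<and> u \<noteq> [] \<and> v \<noteq> [] \<and> P v)"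
  by (rule definable_cong[OF definable_rev[OF definable_prefix[OF definable_rev[OF assms]]]])
    (unfold append_eq_rev_iff, metis rev_is_Nil_conv rev_rev_ident)

lemma definable_suffix_eq:
  assumes "definable A P"
  shows "definable A (\<lambda>w. \<exists>u v. w = u @ v \<and> v \<noteq> [] \<and> P v)"
  by (rule definable_cong[OF definable_or[OF assms definable_suffix[OF assms]]])
    (metis append_Nil)

section \<open>Tests on letters and on length\<close>

lemma definable_all_eq: "definable A (\<lambda>w. \<forall>x\<in>set w. x = a)"
  by (rule definable_cong[OF definable_L_be[of A "BAct a"]]) (auto simp: L_be_BAct)

lemma definable_length_ge_2: "definable A (\<lambda>w. 2 \<le> length w)"
proof (rule definable_cong[OF definable_prefix[OF definable_const[of A True]]])
  fix w :: "'a list"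
  show "(\<exists>u v. w = u @ v \<and> u \<noteq> [] \<and> v \<noteq> [] \<and> True) \<longleftrightarrow> 2 \<le> length w"
  proof
    assume "2 \<le> length w"
    then show "\<exists>u v. w = u @ v \<and> u \<noteq> [] \<and> v \<noteq> [] \<and> True"
      by (intro exI[of _ "take 1 w"] exI[of _ "drop 1 w"]) auto
  qed (auto simp: Suc_le_eq neq_Nil_conv)
qed

text \<open>The atom \<open>BAct a\<close> also accepts longer powers of \<open>a\<close>; having no
  nonempty proper prefix singles out the one-letter word.\<close>

lemma definable_singleton: "definable A (\<lambda>w. w = [a])"
proof (rule definable_cong[OF definable_and[OF definable_all_eq definable_not[OF definable_length_ge_2]]])
  fix w :: "'a list"
  assume "w \<noteq> []"
  then show "(\<forall>x\<in>set w. x = a) \<and> \<not> 2 \<le> length w \<longleftrightarrow> w = [a]"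
    by (cases w) (auto simp: Suc_le_eq)
qed

lemma definable_last: "definable A (\<lambda>w. last w = a)"
  by (rule definable_cong[OF definable_suffix_eq[OF definable_singleton[of A a]]])
    (auto, metis append_butlast_last_id)

lemma definable_hd: "definable A (\<lambda>w. hd w = a)"
  by (rule definable_cong[OF definable_rev[OF definable_last[of A a]]]) (simp add: last_rev)

lemma definable_member: "definable A (\<lambda>w. a \<in> set w)"
  by (rule definable_cong[OF definable_prefix_eq[OF definable_last[of A a]]])
    (auto, metis append.assoc append_Cons append_Nil append_is_Nil_conv last_snoc list.discI split_list)

lemma definable_subset:
  assumes "finite A"
  shows "definable A (\<lambda>w. set w \<subseteq> B)"
  by (rule definable_cong[OF definable_not[OF definable_bex[of "A - B" A "\<lambda>a w. a \<in> set w"]]])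
    (auto simp: assms definable_member)

text \<open>A formula for \<open>B\<close> may behave arbitrarily on words with other letters, hence
  the guard.\<close>

lemma definable_mono:
  assumes "definable B P" "finite A"
  shows "definable A (\<lambda>w. set w \<subseteq> B \<and> P w)"
proof -
  obtain \<psi> where \<psi>: "\<forall>w. w \<noteq> [] \<longrightarrow> set w \<subseteq> B \<longrightarrow> (w \<in> L_be \<psi> \<longleftrightarrow> P w)"
    using assms unfolding definable_def by blast
  show ?thesis
    by (rule definable_cong[OF definable_and[OF definable_subset[OF assms(2), of B] definable_L_be[of A \<psi>]]])
      (use \<psi> in auto)
qed

section \<open>Removing and adding a letter at an end of the word\<close>

lemma butlast_not_Nil: "2 \<le> length w \<Longrightarrow> butlast w \<noteq> []"
  by (cases w rule: rev_cases) auto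

text \<open>Induction on a formula for \<open>P\<close>, using that \<open>butlast w\<close> is the
  longest proper prefix of \<open>w\<close> and that taking suffixes commutes with dropping the last
  letter.\<close>

lemma definable_butlast:
  assumes "definable A P"
  shows "definable A (\<lambda>w. 2 \<le> length w \<and> P (butlast w))"
proof -
  have *: "definable A (\<lambda>w. 2 \<le> length w \<and> butlast w \<in> L_be \<psi>)" for \<psi>
  proof (induction \<psi>)
    case (BAct a)
    \<comment> \<open>All proper prefixes are inspected at once; the longest one contains the
      letters of the others.\<close>
    have "definable A (\<lambda>w. 2 \<le> length w \<and> \<not> (\<exists>u v. w = u @ v \<and> u \<noteq> [] \<and> v \<noteq> [] \<and> \<not> (\<forall>x\<in>set u. x = a)))"
      by (intro definable_and definable_not definable_prefix definable_all_eq definable_length_ge_2)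
    then show ?case
    proof (rule definable_cong)
      fix w :: "'a list" assume "w \<noteq> []"
      then obtain v c where w: "w = v @ [c]" by (metis rev_exhaust)
      show "2 \<le> length w \<and> \<not> (\<exists>u v. w = u @ v \<and> u \<noteq> [] \<and> v \<noteq> [] \<and> \<not> (\<forall>x\<in>set u. x = a)) \<longleftrightarrow>
        2 \<le> length w \<and> butlast w \<in> L_be (BAct a)"
      proof (rule conj_cong[OF refl])
        assume "2 \<le> length w"
        then have v: "v \<noteq> []" using w by auto
        show "\<not> (\<exists>u v. w = u @ v \<and> u \<noteq> [] \<and> v \<noteq> [] \<and> \<not> (\<forall>x\<in>set u. x = a)) \<longleftrightarrow>
          butlast w \<in> L_be (BAct a)" (is "\<not> ?L \<longleftrightarrow> ?R")
        proof
          assume "\<not> ?L"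
          then have "\<forall>x\<in>set v. x = a" using w v by blast
          then show ?R using w v by (simp add: L_be_BAct)
        next
          assume ?R
          then have "\<forall>x\<in>set v. x = a" using w by (simp add: L_be_BAct)
          moreover have "v = x @ butlast y" if "w = x @ y" "y \<noteq> []" for x y
            using that w by (metis butlast_append butlast_snoc)
          ultimately show "\<not> ?L" by (metis Un_iff set_append)
        qed
      qed
    qed
  next
    case (BNot \<psi>)
    show ?case
      by (rule definable_cong[OF definable_and[OF definable_length_ge_2 definable_not[OF BNot]]])
        (auto simp: L_be_BNot butlast_not_Nil)
  next
    case (BAnd \<psi> \<chi>)
    show ?case
      by (rule definable_cong[OF definable_and[OF BAnd]]) (auto simp: L_be_iff)
  next
    case (BB \<psi>)
    \<comment> \<open>The proper prefixes of \<open>butlast w\<close> are the proper prefixes of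
      proper prefixes of \<open>w\<close>, so \<open>BB\<close> is applied twice.\<close>
    show ?case
    proof (rule definable_cong[OF definable_prefix[OF definable_L_be[of A "BB \<psi>"]]])
      fix w :: "'a list" assume "w \<noteq> []"
      then obtain v c where w: "w = v @ [c]" by (metis rev_exhaust)
      show "(\<exists>u v. w = u @ v \<and> u \<noteq> [] \<and> v \<noteq> [] \<and> u \<in> L_be (BB \<psi>)) \<longleftrightarrow>
        2 \<le> length w \<and> butlast w \<in> L_be (BB \<psi>)" (is "?L \<longleftrightarrow> ?R")
      proof
        assume ?L
        then obtain x y z where "v @ [c] = (x @ y) @ z" "x \<noteq> []" "y \<noteq> []" "z \<noteq> []" "x \<in> L_be \<psi>"
          unfolding L_be_BB w by blast
        then have "v = x @ y @ butlast z"
          by (metis append.assoc butlast_append butlast_snoc)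
        then have "v \<in> L_be (BB \<psi>)" unfolding L_be_BB
          using \<open>x \<noteq> []\<close> \<open>y \<noteq> []\<close> \<open>x \<in> L_be \<psi>\<close> by (metis append_is_Nil_conv)
        moreover from this have "v \<noteq> []" by (rule L_be_nonempty)
        ultimately show ?R unfolding w by (auto simp: Suc_le_eq)
      next
        assume ?R
        then show ?L unfolding w using L_be_nonempty by (metis butlast_snoc list.discI)
      qed
    qed
  next
    case (BE \<psi>)
    show ?case
    proof (rule definable_cong[OF definable_suffix[OF BE]])
      fix w :: "'a list" assume "w \<noteq> []"
      then obtain v c where w: "w = v @ [c]" by (metis rev_exhaust)
      show "(\<exists>u v. w = u @ v \<and> u \<noteq> [] \<and> v \<noteq> [] \<and> 2 \<le> length v \<and> butlast v \<in> L_be \<psi>) \<longleftrightarrow>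
        2 \<le> length w \<and> butlast w \<in> L_be (BE \<psi>)" (is "?L \<longleftrightarrow> ?R")
      proof
        assume ?L
        then obtain x y where xy: "v @ [c] = x @ y" "x \<noteq> []" "2 \<le> length y" "butlast y \<in> L_be \<psi>"
          unfolding w by blast
        then have "v = x @ butlast y"
          by (metis butlast_append butlast_snoc L_be_nonempty butlast.simps(1))
        then have "v \<in> L_be (BE \<psi>)" unfolding L_be_BE
          using xy L_be_nonempty by blast
        moreover from this have "v \<noteq> []" by (rule L_be_nonempty)
        ultimately show ?R unfolding w by (auto simp: Suc_le_eq)
      next
        assume ?R
        then obtain x y where xy: "v = x @ y" "x \<noteq> []" "y \<noteq> []" "y \<in> L_be \<psi>"
          unfolding w L_be_BE by auto
        show ?L unfolding w
          by (rule exI[of _ x], rule exI[of _ "y @ [c]"]) (use xy in \<open>auto simp: Suc_le_eq\<close>)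
      qed
    qed
  qed
  obtain \<psi> where \<psi>: "\<forall>w. w \<noteq> [] \<longrightarrow> set w \<subseteq> A \<longrightarrow> (w \<in> L_be \<psi> \<longleftrightarrow> P w)"
    using assms unfolding definable_def by blast
  show ?thesis
  proof (rule definable_cong[OF *[of \<psi>]])
    fix w :: "'a list" assume "w \<noteq> []" "set w \<subseteq> A"
    then have "set (butlast w) \<subseteq> A" "2 \<le> length w \<Longrightarrow> butlast w \<noteq> []"
      by (auto dest: in_set_butlastD simp: butlast_not_Nil)
    then show "2 \<le> length w \<and> butlast w \<in> L_be \<psi> \<longleftrightarrow> 2 \<le> length w \<and> P (butlast w)"
      using \<psi> by blast
  qed
qed

lemma definable_snoc:
  assumes "definable A P"
  shows "definable A (\<lambda>w. \<exists>u. w = u @ [b] \<and> P u)"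
proof -
  \<comment> \<open>For the word \<open>[b]\<close> the remainder is empty; \<open>P []\<close> is
    just a truth value and enters as a constant.\<close>
  have "definable A (\<lambda>w. (w = [b] \<and> P []) \<or> (last w = b \<and> 2 \<le> length w \<and> P (butlast w)))"
    by (intro definable_or definable_and definable_singleton definable_const definable_last
        definable_butlast assms)
  then show ?thesis
  proof (rule definable_cong)
    fix w :: "'a list" assume "w \<noteq> []"
    then obtain v c where w: "w = v @ [c]" by (metis rev_exhaust)
    show "(w = [b] \<and> P []) \<or> (last w = b \<and> 2 \<le> length w \<and> P (butlast w)) \<longleftrightarrow>
      (\<exists>u. w = u @ [b] \<and> P u)"
      unfolding w by (cases v) auto
  qed
qed

lemma definable_Cons:
  assumes "definable A P"
  shows "definable A (\<lambda>w. \<exists>u. w = b # u \<and> P u)"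
  by (rule definable_cong[OF definable_rev[OF definable_snoc[OF definable_rev[OF assms], of b]]])
    (auto simp: append_eq_rev_iff, metis rev_rev_ident)

section \<open>Cutting at a marker letter\<close>

definition upto_last :: "'a \<Rightarrow> 'a list \<Rightarrow> 'a list" where
  "upto_last b w = rev (dropWhile (\<lambda>x. x \<noteq> b) (rev w))"

lemma upto_last_eq:
  assumes "b \<notin> set x"
  shows "upto_last b (v @ b # x) = v @ [b]"
proof -
  have "dropWhile (\<lambda>x. x \<noteq> b) (rev x @ b # rev v) = b # rev v"
    using assms by (subst dropWhile_append2) auto
  then show ?thesis by (simp add: upto_last_def)
qed

text \<open>Induction on a formula for \<open>P\<close>. The cut leaves the longest prefix ending in
  \<open>b\<close>, so atoms and \<open>BB\<close> are tested through the prefixes ending in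
  \<open>b\<close>; for \<open>BE\<close>, cutting commutes with passing to a suffix that still
  contains \<open>b\<close>.\<close>

lemma definable_upto_last:
  assumes "definable A P"
  shows "definable A (\<lambda>w. b \<in> set w \<and> P (upto_last b w))"
proof -
  \<comment> \<open>\<open>x\<close> has no \<open>b\<close>, so a prefix ending in \<open>b\<close>
    cannot reach into it.\<close>
  have pre: "\<exists>t. v @ [b] = u @ t" if "u @ y = v @ b # x" "u \<noteq> []" "last u = b" "b \<notin> set x" for u v x y
  proof -
    have "(u @ y = (v @ [b]) @ x)" using that by simp
    then consider t where "v @ [b] = u @ t" | t where "u = (v @ [b]) @ t" "t @ y = x"
      unfolding append_eq_append_conv2 by metis
    then show ?thesis
    proof cases
      case 2
      then have "t = []" using that by (metis Un_iff last_appendR last_in_set set_append)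
      then show ?thesis using 2 by auto
    qed auto
  qed
  have *: "definable A (\<lambda>w. b \<in> set w \<and> upto_last b w \<in> L_be \<psi>)" for \<psi>
  proof (induction \<psi>)
    case (BAct a)
    have "definable A (\<lambda>w. b \<in> set w \<and>
        \<not> (\<exists>u v. w = u @ v \<and> u \<noteq> [] \<and> last u = b \<and> \<not> (\<forall>x\<in>set u. x = a)))"
      by (intro definable_and definable_not definable_prefix_eq definable_all_eq definable_member
          definable_last)
    then show ?case
    proof (rule definable_cong, intro conj_cong refl)
      fix w :: "'a list" assume "b \<in> set w"
      then obtain v x where w: "w = v @ b # x" "b \<notin> set x" by (metis split_list_last)
      show "\<not> (\<exists>u v. w = u @ v \<and> u \<noteq> [] \<and> last u = b \<and> \<not> (\<forall>x\<in>set u. x = a)) \<longleftrightarrow>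
        upto_last b w \<in> L_be (BAct a)" (is "\<not> ?L \<longleftrightarrow> ?R")
      proof
        assume "\<not> ?L"
        moreover have "w = (v @ [b]) @ x" "v @ [b] \<noteq> []" "last (v @ [b]) = b"
          using w by auto
        ultimately have "\<forall>x\<in>set (v @ [b]). x = a" by blast
        then show ?R using w by (simp add: upto_last_eq L_be_BAct)
      next
        assume ?R
        then have "\<forall>x\<in>set (v @ [b]). x = a" using w by (simp add: upto_last_eq L_be_BAct)
        then show "\<not> ?L" using pre w by (metis Un_iff set_append)
      qed
    qed
  next
    case (BNot \<psi>)
    show ?case
    proof (rule definable_cong[OF definable_and[OF definable_member[of A b] definable_not[OF BNot]]])
      fix w :: "'a list"
      have "upto_last b w \<noteq> []" if "b \<in> set w"
        using split_list_last[OF that] by (auto simp: upto_last_eq)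
      then show "b \<in> set w \<and> \<not> (b \<in> set w \<and> upto_last b w \<in> L_be \<psi>) \<longleftrightarrow>
        b \<in> set w \<and> upto_last b w \<in> L_be (BNot \<psi>)"
        by (auto simp: L_be_BNot)
    qed
  next
    case (BAnd \<psi> \<chi>)
    show ?case
      by (rule definable_cong[OF definable_and[OF BAnd]]) (auto simp: L_be_iff)
  next
    case (BB \<psi>)
    \<comment> \<open>\<open>BB\<close> formulas persist when the word is extended to the right, so
      their truth on some prefix ending in \<open>b\<close> carries over to the longest such
      prefix.\<close>
    have "definable A (\<lambda>w. b \<in> set w \<and>
        (\<exists>u v. w = u @ v \<and> u \<noteq> [] \<and> last u = b \<and> u \<in> L_be (BB \<psi>)))"
      by (intro definable_and definable_prefix_eq definable_member definable_L_be definable_last)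
    then show ?case
    proof (rule definable_cong, intro conj_cong refl)
      fix w :: "'a list" assume "b \<in> set w"
      then obtain v x where w: "w = v @ b # x" "b \<notin> set x" by (metis split_list_last)
      show "(\<exists>u v. w = u @ v \<and> u \<noteq> [] \<and> last u = b \<and> u \<in> L_be (BB \<psi>)) \<longleftrightarrow>
        upto_last b w \<in> L_be (BB \<psi>)" (is "?L \<longleftrightarrow> ?R")
      proof
        assume ?L
        then obtain u y where "u @ y = v @ b # x" "u \<noteq> []" "last u = b" "u \<in> L_be (BB \<psi>)"
          using w by metis
        then obtain t where "v @ [b] = u @ t" using pre w by metis
        then have "v @ [b] \<in> L_be (BB \<psi>)" using \<open>u \<in> L_be (BB \<psi>)\<close>
          unfolding L_be_BB by (metis append.assoc append_is_Nil_conv)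
        then show ?R using w by (simp add: upto_last_eq)
      next
        assume ?R
        moreover have "w = (v @ [b]) @ x" "v @ [b] \<noteq> []" "last (v @ [b]) = b"
          using w by auto
        ultimately show ?L using w by (metis upto_last_eq)
      qed
    qed
  next
    case (BE \<psi>)
    have "definable A (\<lambda>w. b \<in> set w \<and>
        (\<exists>u v. w = u @ v \<and> u \<noteq> [] \<and> v \<noteq> [] \<and> b \<in> set v \<and> upto_last b v \<in> L_be \<psi>))"
      by (intro definable_and definable_suffix definable_member BE)
    then show ?case
    proof (rule definable_cong, intro conj_cong refl)
      fix w :: "'a list" assume "b \<in> set w"
      then obtain v x where w: "w = v @ b # x" "b \<notin> set x" by (metis split_list_last)
      show "(\<exists>u v. w = u @ v \<and> u \<noteq> [] \<and> v \<noteq> [] \<and> b \<in> set v \<and> upto_last b v \<in> L_be \<psi>) \<longleftrightarrow>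
        upto_last b w \<in> L_be (BE \<psi>)" (is "?L \<longleftrightarrow> ?R")
      proof
        assume ?L
        then obtain u y where uy: "w = u @ y" "u \<noteq> []" "b \<in> set y" "upto_last b y \<in> L_be \<psi>"
          by blast
        then obtain v' x' where y: "y = v' @ b # x'" "b \<notin> set x'" by (metis split_list_last)
        then have "upto_last b w = u @ upto_last b y"
          using uy upto_last_eq[of b x' "u @ v'"] by (simp add: upto_last_eq)
        then show ?R unfolding L_be_BE using uy L_be_nonempty by blast
      next
        assume ?R
        then obtain s t where st: "v @ [b] = s @ t" "s \<noteq> []" "t \<noteq> []" "t \<in> L_be \<psi>"
          unfolding L_be_BE using w by (auto simp: upto_last_eq)
        then obtain t' where t: "t = t' @ [b]" by (metis append_butlast_last_id last_appendR last_snoc)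
        have "w = s @ (t' @ b # x)" using st w t by simp
        moreover have "upto_last b (t' @ b # x) \<in> L_be \<psi>" using t st w by (simp add: upto_last_eq)
        ultimately show ?L using st by (metis append_is_Nil_conv in_set_conv_decomp list.discI)
      qed
    qed
  qed
  obtain \<psi> where \<psi>: "\<forall>w. w \<noteq> [] \<longrightarrow> set w \<subseteq> A \<longrightarrow> (w \<in> L_be \<psi> \<longleftrightarrow> P w)"
    using assms unfolding definable_def by blast
  show ?thesis
  proof (rule definable_cong[OF *[of \<psi>]], intro conj_cong refl)
    fix w :: "'a list" assume "b \<in> set w" "set w \<subseteq> A"
    moreover from this obtain v x where w: "w = v @ b # x" "b \<notin> set x" by (metis split_list_last)
    ultimately show "upto_last b w \<in> L_be \<psi> \<longleftrightarrow> P (upto_last b w)"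
      using \<psi> by (auto simp: upto_last_eq)
  qed
qed

text \<open>The last occurrence of \<open>b\<close> is a unique cut, which turns the concatenation
  into a conjunction of independent tests on the two sides.\<close>

lemma definable_append_last:
  assumes "definable A P" "definable A R"
  shows "definable A (\<lambda>w. \<exists>v x. w = v @ b # x \<and> b \<notin> set x \<and> P (v @ [b]) \<and> R x)"
proof -
  have "definable A (\<lambda>w. (b \<in> set w \<and> P (upto_last b w)) \<and>
      (\<exists>v y. w = v @ y \<and> y \<noteq> [] \<and> (\<exists>x. y = b # x \<and> b \<notin> set x \<and> R x)))"
    by (intro definable_and definable_upto_last definable_suffix_eq definable_Cons definable_not
        definable_member assms)
  then show ?thesis
  proof (rule definable_cong)
    fix w :: "'a list"
    show "(b \<in> set w \<and> P (upto_last b w)) \<and>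
        (\<exists>v y. w = v @ y \<and> y \<noteq> [] \<and> (\<exists>x. y = b # x \<and> b \<notin> set x \<and> R x)) \<longleftrightarrow>
      (\<exists>v x. w = v @ b # x \<and> b \<notin> set x \<and> P (v @ [b]) \<and> R x)" (is "?L \<longleftrightarrow> ?R")
    proof
      assume ?L
      then show ?R by (metis upto_last_eq)
    next
      assume ?R
      then obtain v x where "w = v @ b # x" "b \<notin> set x" "P (v @ [b])" "R x" by blast
      then show ?L using upto_last_eq[of b x v] by auto
    qed
  qed
qed

lemma definable_append_first:
  assumes "definable A P" "definable A R"
  shows "definable A (\<lambda>w. \<exists>u y. w = u @ b # y \<and> b \<notin> set u \<and> R u \<and> P (b # y))"
proof (rule definable_cong[OF definable_rev[OF definable_append_last[OF definable_rev[OF assms(1)]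
        definable_rev[OF assms(2)], of b]]])
  fix w :: "'a list"
  show "(\<exists>v x. rev w = v @ b # x \<and> b \<notin> set x \<and> P (rev (v @ [b])) \<and> R (rev x)) \<longleftrightarrow>
    (\<exists>u y. w = u @ b # y \<and> b \<notin> set u \<and> R u \<and> P (b # y))" (is "?L \<longleftrightarrow> ?R")
  proof
    assume ?L
    then obtain v x where "w = rev x @ b # rev v" "b \<notin> set x" "P (b # rev v)" "R (rev x)"
      by (auto simp: append_eq_rev_iff)
    then show ?R by (intro exI[of _ "rev x"] exI[of _ "rev v"]) auto
  next
    assume ?R
    then obtain u y where "w = u @ b # y" "b \<notin> set u" "R u" "P (b # y)" by blast
    then show ?L by (intro exI[of _ "rev y"] exI[of _ "rev u"]) auto
  qed
qed

section \<open>Substituting blocks for letters\<close>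

text \<open>The word \<open>b u1 b u2 b ... un b\<close>. The opening marker makes each consecutive
  group of blocks start and end with \<open>b\<close>; the empty list yields
  \<open>[b]\<close>.\<close>

definition blocks :: "'a \<Rightarrow> 'a list list \<Rightarrow> 'a list" where
  "blocks b us = b # concat (map (\<lambda>u. u @ [b]) us)"

lemma blocks_snoc: "\<exists>c. blocks b us = c @ [b] \<and> (us \<noteq> [] \<longrightarrow> c \<noteq> [])"
  by (induction us rule: rev_induct) (auto simp: blocks_def)

text \<open>Neighbouring groups of blocks share a marker, so one copy of it is dropped when they are
  joined.\<close>

lemma blocks_append': "blocks b (us @ vs) = blocks b us @ tl (blocks b vs)"
  by (simp add: blocks_def)

lemma blocks_append: "blocks b (us @ vs) = butlast (blocks b us) @ blocks b vs"
proof -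
  obtain c where "blocks b us = c @ [b]" using blocks_snoc[of b us] by blast
  moreover have "blocks b vs = b # tl (blocks b vs)" by (simp add: blocks_def)
  ultimately show ?thesis unfolding blocks_append' by (metis append.assoc append_Cons append_Nil butlast_snoc)
qed

lemma length_blocks_ge_2: "2 \<le> length (blocks b us) \<longleftrightarrow> us \<noteq> []"
  by (cases us) (auto simp: blocks_def)

lemma last_blocks: "last (blocks b us) = b"
  using blocks_snoc[of b us] by auto

lemma hd_blocks: "hd (blocks b us) = b"
  by (simp add: blocks_def)

lemma blocks_not_Nil [simp]: "blocks b us \<noteq> []"
  by (simp add: blocks_def)

lemma blocks_Cons: "blocks b (u # us) = b # u @ blocks b us"
  by (simp add: blocks_def)

text \<open>Blocks are free of \<open>b\<close>, so a suffix starting with \<open>b\<close> starts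
  at a marker.\<close>

lemma blocks_suffix:
  assumes "blocks b us = u @ v" "v \<noteq> []" "hd v = b" "\<forall>u\<in>set us. b \<notin> set u"
  shows "\<exists>us1 us2. us = us1 @ us2 \<and> v = blocks b us2"
  using assms
proof (induction us arbitrary: u)
  case Nil
  then show ?case by (auto simp: blocks_def Cons_eq_append_conv)
next
  case step: (Cons x us)
  show ?case
  proof (cases u)
    case Nil
    then show ?thesis using step.prems by (metis append_Nil)
  next
    case (Cons c u')
    then have eq: "x @ blocks b us = u' @ v" using step.prems by (auto simp: blocks_Cons)
    then consider t where "x = u' @ t" "t @ blocks b us = v" | t where "u' = x @ t" "blocks b us = t @ v"
      unfolding append_eq_append_conv2 by metis
    then have "\<exists>t. blocks b us = t @ v"
    proof cases
      case 1
      then have "t = []" using step.prems by (cases t) auto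
      then show ?thesis using 1 by auto
    qed auto
    then show ?thesis using step.IH step.prems by (metis append_Cons list.set_intros(2))
  qed
qed

lemma blocks_prefix:
  assumes "blocks b us = u @ v" "u \<noteq> []" "last u = b" "\<forall>u\<in>set us. b \<notin> set u"
  shows "\<exists>us1 us2. us = us1 @ us2 \<and> u = blocks b us1"
proof -
  obtain c where c: "u = c @ [b]" using assms by (metis append_butlast_last_id)
  \<comment> \<open>The suffix beginning at the final \<open>b\<close> of \<open>u\<close> overlaps
    \<open>u\<close> in that marker; it is again a block word, and cancelling what follows the
    marker determines \<open>u\<close>.\<close>
  then have "blocks b us = c @ (b # v)" using assms by simp
  then obtain us1 us2 where "us = us1 @ us2" "b # v = blocks b us2"
    using blocks_suffix assms(4) by (metis list.discI list.sel(1))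
  moreover from this have "u = blocks b us1"
    using assms(1) blocks_append'[of b us1 us2] by (metis append_same_eq list.sel(3))
  ultimately show ?thesis by blast
qed

text \<open>The first \<open>b\<close> after the opening marker ends the first block on both
  sides.\<close>

lemma blocks_inj:
  assumes "blocks b us = blocks b vs" "\<forall>u\<in>set us. b \<notin> set u" "\<forall>u\<in>set vs. b \<notin> set u"
  shows "us = vs"
  using assms
proof (induction us arbitrary: vs)
  case Nil
  then show ?case using length_blocks_ge_2 by metis
next
  case (Cons u us)
  then have "vs \<noteq> []" using length_blocks_ge_2 by (metis list.discI)
  then obtain v vs' where vs: "vs = v # vs'" by (cases vs) auto
  obtain x y where xy: "blocks b us = b # x" "blocks b vs' = b # y" by (simp add: blocks_def)
  have "u @ b # x = v @ b # y" using Cons.prems vs xy by (simp add: blocks_Cons)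
  moreover have "b \<notin> set u" "b \<notin> set v" using Cons.prems vs by auto
  ultimately have "u = v \<and> x = y"
    by (auto simp: append_eq_append_conv2 Cons_eq_append_conv append_eq_Cons_conv)
  then show ?case using Cons vs xy by auto
qed

lemma blocks_exhaust:
  assumes "w \<noteq> []" "hd w = b" "last w = b"
  shows "\<exists>us. w = blocks b us \<and> (\<forall>u\<in>set us. b \<notin> set u)"
  using assms
proof (induction "length w" arbitrary: w rule: less_induct)
  case less
  then obtain y where w: "w = b # y" by (cases w) auto
  show ?case
  proof (cases "y = []")
    case True
    then show ?thesis using w by (intro exI[of _ "[]"]) (simp add: blocks_def)
  next
    case False
    then have "b \<in> set y" using less.prems w by (metis last_ConsR last_in_set)
    then obtain u x where y: "y = u @ b # x" "b \<notin> set u" by (metis split_list_first)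
    then obtain us where us: "b # x = blocks b us" "\<forall>u\<in>set us. b \<notin> set u"
      using less.hyps[of "b # x"] less.prems w by auto
    then show ?thesis using w y by (intro exI[of _ "u # us"]) (auto simp: blocks_Cons)
  qed
qed

text \<open>Pulls a formula over the images \<open>f u\<close> back to words over \<open>A\<close>,
  by induction on the formula: proper prefixes of the list of blocks correspond to prefixes ending
  in \<open>b\<close>, proper suffixes to those starting with \<open>b\<close>. Only the test for a
  single block, supplied by \<open>base\<close>, depends on \<open>f\<close>.\<close>

lemma definable_blocks:
  assumes base: "\<And>t. definable A (\<lambda>w. \<exists>u. w = b # u @ [b] \<and> b \<notin> set u \<and> f u \<noteq> t)"
  shows "\<exists>P. definable A P \<and> (\<forall>us. us \<noteq> [] \<longrightarrow> (\<forall>u\<in>set us. b \<notin> set u) \<longrightarrow>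
    (P (blocks b us) \<longleftrightarrow> map f us \<in> L_be \<psi>))"
proof (induction \<psi>)
  case (BAct t)
  \<comment> \<open>The atom \<open>BAct t\<close> excludes factors \<open>b u b\<close> with
    \<open>f u\<close> different from \<open>t\<close>; a factor is a suffix of a prefix.\<close>
  let ?P = "\<lambda>w. \<not> (\<exists>x y. w = x @ y \<and> x \<noteq> [] \<and> (\<exists>x1 x2. x = x1 @ x2 \<and> x2 \<noteq> [] \<and>
    (\<exists>u. x2 = b # u @ [b] \<and> b \<notin> set u \<and> f u \<noteq> t)))"
  have "definable A ?P"
    by (intro definable_not definable_prefix_eq definable_suffix_eq base)
  moreover have "?P (blocks b us) \<longleftrightarrow> map f us \<in> L_be (BAct t)"
    if us: "us \<noteq> []" "\<forall>u\<in>set us. b \<notin> set u" for us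
  proof
    assume P: "?P (blocks b us)"
    have "f u = t" if "u \<in> set us" for u
    proof (rule ccontr)
      assume "f u \<noteq> t"
      obtain us1 us2 where us': "us = us1 @ u # us2" using \<open>u \<in> set us\<close> by (metis split_list)
      have "blocks b us = (butlast (blocks b us1) @ (b # u @ [b])) @ concat (map (\<lambda>u. u @ [b]) us2)"
        unfolding us' blocks_append by (simp add: blocks_def)
      moreover have "b \<notin> set u" using us us' by auto
      ultimately show False using P \<open>f u \<noteq> t\<close> by blast
    qed
    then show "map f us \<in> L_be (BAct t)" using us by (auto simp: L_be_BAct)
  next
    assume t: "map f us \<in> L_be (BAct t)"
    show "?P (blocks b us)"
    proof
      assume "\<exists>x y. blocks b us = x @ y \<and> x \<noteq> [] \<and> (\<exists>x1 x2. x = x1 @ x2 \<and> x2 \<noteq> [] \<and>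
        (\<exists>u. x2 = b # u @ [b] \<and> b \<notin> set u \<and> f u \<noteq> t))"
      then obtain x1 y u where u: "blocks b us = (x1 @ b # u @ [b]) @ y" "b \<notin> set u" "f u \<noteq> t"
        by blast
      obtain us1 us2 where 1: "us = us1 @ us2" "x1 @ b # u @ [b] = blocks b us1"
        using blocks_prefix[OF u(1)] us by auto
      obtain vs1 vs2 where 2: "us1 = vs1 @ vs2" "b # u @ [b] = blocks b vs2"
        using blocks_suffix[OF 1(2)[symmetric]] us 1(1) by auto
      \<comment> \<open>The factor encodes a one-element list, so injectivity makes \<open>u\<close>
        one of the blocks.\<close>
      have "blocks b [u] = blocks b vs2" using 2 by (simp add: blocks_def)
      then have "[u] = vs2" by (rule blocks_inj) (use u us 1 2 in auto)
      then have "u \<in> set us" using 1 2 by auto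
      then show False using t u by (auto simp: L_be_BAct)
    qed
  qed
  ultimately show ?case by blast
next
  case (BNot \<psi>)
  then obtain P where P: "definable A P" "\<forall>us. us \<noteq> [] \<longrightarrow> (\<forall>u\<in>set us. b \<notin> set u) \<longrightarrow>
    (P (blocks b us) \<longleftrightarrow> map f us \<in> L_be \<psi>)" by blast
  show ?case
    by (rule exI[of _ "\<lambda>w. \<not> P w"]) (use P in \<open>auto simp: L_be_BNot intro: definable_not\<close>)
next
  case (BAnd \<psi> \<chi>)
  then obtain P R where P: "definable A P" "\<forall>us. us \<noteq> [] \<longrightarrow> (\<forall>u\<in>set us. b \<notin> set u) \<longrightarrow>
    (P (blocks b us) \<longleftrightarrow> map f us \<in> L_be \<psi>)"
    and R: "definable A R" "\<forall>us. us \<noteq> [] \<longrightarrow> (\<forall>u\<in>set us. b \<notin> set u) \<longrightarrow>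
    (R (blocks b us) \<longleftrightarrow> map f us \<in> L_be \<chi>)" by blast
  show ?case
    by (rule exI[of _ "\<lambda>w. P w \<and> R w"]) (use P R in \<open>auto simp: L_be_iff intro: definable_and\<close>)
next
  case (BB \<psi>)
  then obtain P where P: "definable A P" "\<And>us. us \<noteq> [] \<Longrightarrow> \<forall>u\<in>set us. b \<notin> set u \<Longrightarrow>
    (P (blocks b us) \<longleftrightarrow> map f us \<in> L_be \<psi>)" by blast
  \<comment> \<open>The bound on the length excludes the prefix \<open>[b]\<close>, which encodes
    the empty list of blocks and hence no word.\<close>
  let ?P = "\<lambda>w. \<exists>u v. w = u @ v \<and> u \<noteq> [] \<and> v \<noteq> [] \<and> last u = b \<and> 2 \<le> length u \<and> P u"
  have "definable A ?P"
    by (intro definable_prefix definable_and definable_last definable_length_ge_2 P(1))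
  moreover have "?P (blocks b us) \<longleftrightarrow> map f us \<in> L_be (BB \<psi>)"
    if us: "\<forall>u\<in>set us. b \<notin> set u" for us
  proof
    assume "?P (blocks b us)"
    then obtain u v where uv: "blocks b us = u @ v" "u \<noteq> []" "v \<noteq> []" "last u = b" "2 \<le> length u" "P u"
      by blast
    then obtain us1 us2 where 1: "us = us1 @ us2" "u = blocks b us1" using blocks_prefix us by metis
    then have "us1 \<noteq> []" using uv length_blocks_ge_2 by metis
    moreover have "us2 \<noteq> []" using uv 1 by auto
    moreover have "map f us1 \<in> L_be \<psi>" using P(2)[of us1] uv 1 us \<open>us1 \<noteq> []\<close> by auto
    ultimately show "map f us \<in> L_be (BB \<psi>)" unfolding L_be_BB 1 by auto
  next
    assume "map f us \<in> L_be (BB \<psi>)"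
    then obtain us1 us2 where 1: "us = us1 @ us2" "us1 \<noteq> []" "us2 \<noteq> []" "map f us1 \<in> L_be \<psi>"
      unfolding L_be_BB map_eq_append_conv by blast
    then have "P (blocks b us1)" using P(2)[of us1] us by auto
    moreover have "tl (blocks b us2) \<noteq> []" using 1 by (cases us2) (auto simp: blocks_def)
    ultimately show "?P (blocks b us)" unfolding 1 blocks_append'
      using last_blocks length_blocks_ge_2 1 blocks_not_Nil by metis
  qed
  ultimately show ?case by blast
next
  case (BE \<psi>)
  then obtain P where P: "definable A P" "\<And>us. us \<noteq> [] \<Longrightarrow> \<forall>u\<in>set us. b \<notin> set u \<Longrightarrow>
    (P (blocks b us) \<longleftrightarrow> map f us \<in> L_be \<psi>)" by blast
  let ?P = "\<lambda>w. \<exists>u v. w = u @ v \<and> u \<noteq> [] \<and> v \<noteq> [] \<and> hd v = b \<and> 2 \<le> length v \<and> P v"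
  have "definable A ?P"
    by (intro definable_suffix definable_and definable_hd definable_length_ge_2 P(1))
  moreover have "?P (blocks b us) \<longleftrightarrow> map f us \<in> L_be (BE \<psi>)"
    if us: "\<forall>u\<in>set us. b \<notin> set u" for us
  proof
    assume "?P (blocks b us)"
    then obtain u v where uv: "blocks b us = u @ v" "u \<noteq> []" "v \<noteq> []" "hd v = b" "2 \<le> length v" "P v"
      by blast
    then obtain us1 us2 where 1: "us = us1 @ us2" "v = blocks b us2" using blocks_suffix us by metis
    then have "us2 \<noteq> []" using uv length_blocks_ge_2 by metis
    moreover have "us1 \<noteq> []" using uv 1 by auto
    moreover have "map f us2 \<in> L_be \<psi>" using P(2)[of us2] uv 1 us \<open>us2 \<noteq> []\<close> by auto
    ultimately show "map f us \<in> L_be (BE \<psi>)" unfolding L_be_BE 1 by auto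
  next
    assume "map f us \<in> L_be (BE \<psi>)"
    then obtain us1 us2 where 1: "us = us1 @ us2" "us1 \<noteq> []" "us2 \<noteq> []" "map f us2 \<in> L_be \<psi>"
      unfolding L_be_BE map_eq_append_conv by blast
    then have "P (blocks b us2)" using P(2)[of us2] us by auto
    moreover have "butlast (blocks b us1) \<noteq> []" using 1 blocks_snoc[of b us1] by auto
    ultimately show "?P (blocks b us)" unfolding 1 blocks_append
      using hd_blocks length_blocks_ge_2 1 blocks_not_Nil by metis
  qed
  ultimately show ?case by blast
qed

section \<open>Counter-free automata\<close>

text \<open>Letters are themselves functions on states, so that the alphabet of the smaller automaton in
  the induction has the same type as the original one.\<close>

fun run :: "('q \<Rightarrow> 'q) list \<Rightarrow> 'q \<Rightarrow> 'q" where
  "run [] q = q"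
| "run (f # w) q = run w (f q)"

lemma run_append [simp]: "run (v @ w) q = run w (run v q)"
  by (induction v arbitrary: q) auto

text \<open>McNaughton and Papert's condition, stated for single states: no word induces a
  nontrivial cycle in \<open>Q\<close>.\<close>

definition counter_free :: "'q set \<Rightarrow> ('q \<Rightarrow> 'q) set \<Rightarrow> bool" where
  "counter_free Q A \<longleftrightarrow> (\<forall>w q n. set w \<subseteq> A \<longrightarrow> q \<in> Q \<longrightarrow> 0 < n \<longrightarrow>
     (run w ^^ n) q = q \<longrightarrow> run w q = q)"

lemma run_closed:
  assumes "\<forall>f\<in>A. f ` Q \<subseteq> Q" "set w \<subseteq> A" "q \<in> Q"
  shows "run w q \<in> Q"
  using assms(2,3)
proof (induction w arbitrary: q)
  case (Cons f w)
  then have "f q \<in> Q" using assms(1) by auto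
  then show ?case using Cons by simp
qed simp

text \<open>A surjection of a finite set onto itself is a permutation, so some power returns to
  \<open>q\<close>, and counter-freeness applies to the one-letter word.\<close>

lemma counter_free_surj_imp_id:
  assumes "finite Q" "counter_free Q A" "f \<in> A" "f ` Q = Q" "q \<in> Q"
  shows "f q = q"
proof -
  \<comment> \<open>Extending \<open>f\<close> by the identity outside \<open>Q\<close> gives a
    function that is injective everywhere, as \<open>funpow_inj_finite\<close> requires.\<close>
  define g where "g x = (if x \<in> Q then f x else x)" for x
  have "inj_on f Q" using assms by (simp add: eq_card_imp_inj_on)
  then have "inj g" using assms(4) unfolding inj_def g_def inj_on_def by (metis imageI)
  have g: "(g ^^ n) q = (f ^^ n) q \<and> (f ^^ n) q \<in> Q" for n
    using assms(4,5) by (induction n) (auto simp: g_def)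
  then have "{y. \<exists>n. y = (g ^^ n) q} \<subseteq> Q" by auto
  then have "finite {y. \<exists>n. y = (g ^^ n) q}" using assms(1) finite_subset by blast
  then obtain n where "0 < n" "(g ^^ n) q = q"
    using funpow_inj_finite[OF \<open>inj g\<close>] by metis
  moreover have "run [f] = f" by (simp add: fun_eq_iff)
  ultimately have "set [f] \<subseteq> A" "(run [f] ^^ n) q = q" using assms(3) g by simp_all
  then have "run [f] q = q" using assms(2,5) \<open>0 < n\<close> unfolding counter_free_def by blast
  then show ?thesis by simp
qed

text \<open>The two induction hypotheses are the assumptions \<open>smaller_alphabet\<close> and
  \<open>fewer_states\<close>. A word containing \<open>b\<close> is cut at its first and last
  \<open>b\<close>; quantifying over the states at the cuts makes the three factors
  independent.\<close>

lemma definable_run_step: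
  assumes fin: "finite Q" "finite A"
    and closed: "\<forall>f\<in>A. f ` Q \<subseteq> Q"
    and cf: "counter_free Q A"
    and b: "b \<in> A"
    and smaller_alphabet: "\<And>p q. p \<in> Q \<Longrightarrow> definable (A - {b}) (\<lambda>w. run w p = q)"
    and fewer_states: "\<And>T p q. finite T \<Longrightarrow> \<forall>f\<in>T. f ` (b ` Q) \<subseteq> b ` Q \<Longrightarrow>
      counter_free (b ` Q) T \<Longrightarrow> p \<in> b ` Q \<Longrightarrow> definable T (\<lambda>w. run w p = q)"
    and p: "p \<in> Q"
  shows "definable A (\<lambda>w. run w p = q)"
proof -
  let ?B = "{u. set u \<subseteq> A - {b}}"
  let ?Q = "b ` Q"
  have bQ: "?Q \<subseteq> Q" using closed b by auto
  have closedA: "run w x \<in> Q" if "set w \<subseteq> A" "x \<in> Q" for w x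
    using run_closed[OF closed] that by blast
  have short: "definable A (\<lambda>w. b \<notin> set w \<and> run w x = y)" if "x \<in> Q" for x y
    by (rule definable_cong[OF definable_mono[OF smaller_alphabet[OF that] fin(2)]]) auto

  \<comment> \<open>This is the action of a block with its closing \<open>b\<close>. Restriction to
    \<open>?Q\<close> makes it extensional, so only finitely many functions arise from arbitrarily
    long blocks.\<close>
  define f where "f u = restrict (run (u @ [b])) ?Q" for u
  define T where "T = f ` ?B"
  have f_closed: "f u x \<in> ?Q" if "u \<in> ?B" "x \<in> ?Q" for u x
  proof -
    have "run u x \<in> Q" using closedA that bQ by blast
    then show ?thesis using that by (simp add: f_def)
  qed
  have T_closed: "\<forall>g\<in>T. g ` ?Q \<subseteq> ?Q"
    using f_closed unfolding T_def by blast
  have "T \<subseteq> ?Q \<rightarrow>\<^sub>E ?Q"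
    using f_closed unfolding T_def by (auto simp: f_def)
  then have "finite T"
    using fin(1) by (meson finite_PiE finite_imageI finite_subset)
  have run_map: "run (map f us) x = run (concat (map (\<lambda>u. u @ [b]) us)) x"
    if "set us \<subseteq> ?B" "x \<in> ?Q" for us x
    using that
  proof (induction us arbitrary: x)
    case (Cons u us)
    then have "f u x \<in> ?Q" using f_closed by auto
    moreover have "f u x = b (run u x)" using Cons.prems by (simp add: f_def)
    ultimately show ?case using Cons by simp
  qed simp
  \<comment> \<open>A cycle under a word of block functions is a cycle under the underlying word
    over \<open>A\<close>; the two actions agree because the states stay in
    \<open>?Q\<close>.\<close>
  have "counter_free ?Q T"
    unfolding counter_free_def
  proof (intro allI impI)
    fix v x n
    assume v: "set v \<subseteq> T" "x \<in> ?Q" "0 < (n::nat)" "(run v ^^ n) x = x"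
    have "v \<in> lists (f ` ?B)" using v(1) by (auto simp: T_def)
    then obtain us where us: "v = map f us" "set us \<subseteq> ?B"
      by (auto simp: lists_image)
    let ?w = "concat (map (\<lambda>u. u @ [b]) us)"
    have w: "set ?w \<subseteq> A" using us b by auto
    have "(run v ^^ k) x = (run ?w ^^ k) x \<and> (run v ^^ k) x \<in> ?Q" for k
    proof (induction k)
      case (Suc k)
      then have "(run v ^^ k) x \<in> ?Q" by blast
      then have "run v ((run v ^^ k) x) = run ?w ((run v ^^ k) x)" "run v ((run v ^^ k) x) \<in> ?Q"
        using run_map[OF us(2)] run_closed[OF T_closed v(1)] us(1) by blast+
      then show ?case using Suc by simp
    qed (use v in simp)
    then have "(run ?w ^^ n) x = x" using v by metis
    then have "run ?w x = x" using cf w v bQ unfolding counter_free_def by blast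
    then show "run v x = x" using run_map[OF us(2)] v us by simp
  qed
  note T = fewer_states[OF \<open>finite T\<close> T_closed \<open>counter_free ?Q T\<close>]

  have base: "definable A (\<lambda>w. \<exists>u. w = b # u @ [b] \<and> b \<notin> set u \<and> f u \<noteq> t)" for t
  proof -
    \<comment> \<open>A non-extensional \<open>t\<close> is never the action of a block; otherwise
      inequality is witnessed by some \<open>x\<close> in \<open>?Q\<close> that \<open>u\<close>
      followed by \<open>b\<close> sends elsewhere. The state \<open>y\<close> stands for
      \<open>run u x\<close>, so that \<open>short\<close> applies.\<close>
    define P where "P u \<longleftrightarrow> b \<notin> set u \<and> (t \<notin> extensional ?Q \<or>
        (\<exists>x\<in>?Q. \<exists>y\<in>{y\<in>Q. b y \<noteq> t x}. b \<notin> set u \<and> run u x = y))" for u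
    have "definable A P"
      unfolding P_def using fin bQ by (intro definable_and definable_or definable_bex definable_const short
          definable_not[OF definable_member]) auto
    then have "definable A (\<lambda>w. \<exists>v. w = b # v \<and> (\<exists>u. v = u @ [b] \<and> P u))"
      by (intro definable_Cons definable_snoc)
    then show ?thesis
    proof (rule definable_cong)
      fix w
      assume wA: "set w \<subseteq> A"
      have "P u \<longleftrightarrow> b \<notin> set u \<and> f u \<noteq> t" if "w = b # u @ [b]" for u
      proof -
        have Q: "run u x \<in> Q" if "x \<in> ?Q" for x
          using closedA[of u x] wA \<open>w = b # u @ [b]\<close> bQ that by auto
        have "f u = t \<longleftrightarrow> t \<in> extensional ?Q \<and> (\<forall>x\<in>?Q. b (run u x) = t x)"
        proof
          assume "f u = t"
          then show "t \<in> extensional ?Q \<and> (\<forall>x\<in>?Q. b (run u x) = t x)"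
            by (auto simp: f_def)
        next
          assume t: "t \<in> extensional ?Q \<and> (\<forall>x\<in>?Q. b (run u x) = t x)"
          show "f u = t"
            by (rule extensionalityI[of _ ?Q]) (use t in \<open>auto simp: f_def\<close>)
        qed
        then show ?thesis using Q unfolding P_def by auto
      qed
      then show "(\<exists>v. w = b # v \<and> (\<exists>u. v = u @ [b] \<and> P u)) \<longleftrightarrow>
        (\<exists>u. w = b # u @ [b] \<and> b \<notin> set u \<and> f u \<noteq> t)"
        by blast
    qed
  qed

  \<comment> \<open>The first \<open>b\<close> has already led to the state \<open>r\<close> in
    \<open>?Q\<close>, so the run continues on \<open>tl w\<close>.\<close>
  have middle: "definable A (\<lambda>w. hd w = b \<and> last w = b \<and> run (tl w) r = s)" if r: "r \<in> ?Q" for r s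
  proof -
    obtain \<psi> where \<psi>: "\<forall>w. w \<noteq> [] \<longrightarrow> set w \<subseteq> T \<longrightarrow> (w \<in> L_be \<psi> \<longleftrightarrow> run w r = s)"
      using T[OF r] unfolding definable_def by blast
    obtain P where P: "definable A P" "\<forall>us. us \<noteq> [] \<longrightarrow> (\<forall>u\<in>set us. b \<notin> set u) \<longrightarrow>
        (P (blocks b us) \<longleftrightarrow> map f us \<in> L_be \<psi>)"
      using definable_blocks[OF base] by blast
    \<comment> \<open>The word \<open>[b]\<close> encodes the empty list of blocks, about which
      \<open>P\<close> says nothing.\<close>
    have "definable A (\<lambda>w. (w = [b] \<and> r = s) \<or> (hd w = b \<and> last w = b \<and> 2 \<le> length w \<and> P w))"
      by (intro definable_or definable_and definable_singleton definable_const definable_hd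
          definable_last definable_length_ge_2 P)
    then show ?thesis
    proof (rule definable_cong)
      fix w
      assume w: "w \<noteq> []" "set w \<subseteq> A"
      show "(w = [b] \<and> r = s) \<or> (hd w = b \<and> last w = b \<and> 2 \<le> length w \<and> P w) \<longleftrightarrow>
        hd w = b \<and> last w = b \<and> run (tl w) r = s"
      proof (cases "hd w = b \<and> last w = b \<and> 2 \<le> length w")
        case True
        then obtain us where us: "w = blocks b us" "\<forall>u\<in>set us. b \<notin> set u"
          using blocks_exhaust w by metis
        then have "us \<noteq> []" using True length_blocks_ge_2 by metis
        have usB: "set us \<subseteq> ?B" using us w \<open>us \<noteq> []\<close> by (auto simp: blocks_def)
        then have "set (map f us) \<subseteq> T" by (auto simp: T_def)
        then have "P w \<longleftrightarrow> run (map f us) r = s"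
          using P us \<psi> \<open>us \<noteq> []\<close> by simp
        also have "\<dots> \<longleftrightarrow> run (tl w) r = s"
          using run_map[OF usB r] us by (simp add: blocks_def)
        finally have "P w \<longleftrightarrow> run (tl w) r = s" .
        moreover have "w \<noteq> [b]"
        proof
          assume "w = [b]"
          then have "length w = 1" by simp
          then show False using True by simp
        qed
        ultimately show ?thesis using True by blast
      next
        case False
        show ?thesis
        proof (cases "hd w = b \<and> last w = b")
          case True
          then have "\<not> 2 \<le> length w" using False by blast
          moreover have "0 < length w" using w(1) by simp
          ultimately have "length w = 1" by linarith
          then obtain c where c: "w = [c]" by (auto simp: length_Suc_conv)
          then have "hd w = c" by simp
          then have "w = [b]" using c True by blast
          then show ?thesis by simp
        next
          case False
          moreover have "hd [b] = b" "last [b] = b" by simp_all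
          ultimately show ?thesis by metis
        qed
      qed
    qed
  qed

  \<comment> \<open>State \<open>r\<close> is reached before the first \<open>b\<close> and
    \<open>s\<close> after the last. The cut at the last \<open>b\<close> keeps it in
    \<open>v @ [b]\<close>, which is then cut at its first \<open>b\<close>; if \<open>b\<close>
    occurs once, \<open>y\<close> is empty.\<close>
  have "definable A (\<lambda>w. (b \<notin> set w \<and> run w p = q) \<or> (\<exists>r\<in>Q. \<exists>s\<in>Q.
      \<exists>v x. w = v @ b # x \<and> b \<notin> set x \<and>
        (\<exists>u y. v @ [b] = u @ b # y \<and> b \<notin> set u \<and> (b \<notin> set u \<and> run u p = r) \<and>
          (hd (b # y) = b \<and> last (b # y) = b \<and> run (tl (b # y)) (b r) = s)) \<and>
        (b \<notin> set x \<and> run x s = q)))"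
    using fin p by (intro definable_or definable_bex definable_append_last
      definable_append_first[where P = "\<lambda>z. hd z = b \<and> last z = b \<and> run (tl z) _ = _"]
      short middle) auto
  then show ?thesis
  proof (rule definable_cong, goal_cases)
    case (1 w)
    show ?case (is "?L \<longleftrightarrow> ?R")
    proof
      assume ?L
      then consider "?R" | u v x y where "w = v @ b # x" "v @ [b] = u @ b # y"
          "run x (run y (b (run u p))) = q"
        by fastforce
      then show ?R
      proof cases
        case 2
        then have "w = (u @ b # y) @ x" by (metis append.assoc append_Cons append_Nil)
        then show ?thesis using 2(3) by simp
      qed
    next
      assume R: ?R
      show ?L
      proof (cases "b \<in> set w")
        case True
        then obtain v x where w: "w = v @ b # x" "b \<notin> set x" by (metis split_list_last)
        have "b \<in> set (v @ [b])" by simp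
        then obtain u y where v: "v @ [b] = u @ b # y" "b \<notin> set u" by (metis split_list_first)
        have "last (b # y) = b" using v by (metis last_appendR last_snoc list.discI)
        have w': "w = (u @ b # y) @ x" using w v by (metis append.assoc append_Cons append_Nil)
        have "set u \<subseteq> A" "set (u @ b # y) \<subseteq> A" using 1 w' by auto
        then have "run u p \<in> Q" "run (u @ b # y) p \<in> Q"
          using closedA p by blast+
        moreover have "run x (run (u @ b # y) p) = q" using R unfolding w' by simp
        ultimately show ?thesis
          using w v \<open>last (b # y) = b\<close>
          by (intro disjI2 bexI[of _ "run u p"] bexI[of _ "run (u @ b # y) p"]
              exI[of _ v] exI[of _ x] conjI exI[of _ u] exI[of _ y]) auto
      qed (use R in auto)
    qed
  qed
qed

text \<open>The number of states is the outer measure and its hypothesis covers all finite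
  alphabets, because the alphabet of block functions can be larger than \<open>A\<close>.\<close>

theorem definable_counter_free:
  assumes "finite Q" "finite A" "\<forall>f\<in>A. f ` Q \<subseteq> Q" "counter_free Q A" "p \<in> Q"
  shows "definable A (\<lambda>w. run w p = q)"
  using assms
proof (induction "card Q" arbitrary: Q A p q rule: less_induct)
  case states: less
  note IH = states.hyps
  show ?case
    using states.prems(2-5)
  proof (induction "card A" arbitrary: A p q rule: less_induct)
    case less
    show ?case
    proof (cases "\<exists>b\<in>A. b ` Q \<noteq> Q")
      case True
      then obtain b where b: "b \<in> A" "b ` Q \<noteq> Q" by blast
      then have "b ` Q \<subset> Q" using less.prems by auto
      then have "card (b ` Q) < card Q" using states.prems(1) by (simp add: psubset_card_mono)
      note fewer = IH[OF this finite_imageI[OF states.prems(1)]]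
      have "card (A - {b}) < card A" by (rule card_Diff1_less[OF less.prems(1) b(1)])
      moreover have "counter_free Q (A - {b})"
        using less.prems unfolding counter_free_def by blast
      ultimately have "definable (A - {b}) (\<lambda>w. run w p = q)" if "p \<in> Q" for p q
        using less.hyps that less.prems by simp
      then show ?thesis
        using definable_run_step[OF states.prems(1) less.prems(1-3) b(1) _ fewer less.prems(4)]
        by blast
    next
      case False
      \<comment> \<open>All letters map \<open>Q\<close> onto itself, hence fix each state by
        counter-freeness; the run never leaves \<open>p\<close>.\<close>
      have "run w p = p" if "set w \<subseteq> A" for w
        using that
      proof (induction w)
        case (Cons f w)
        then show ?case
          using counter_free_surj_imp_id[OF states.prems(1) less.prems(3), of f p] False less.prems(4)
          by simp
      qed simp
      then show ?thesis
        by (intro definable_cong[OF definable_const[of A "p = q"]]) simp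
    qed
  qed
qed

text \<open>Renaming letters commutes with splitting, so only atoms change: \<open>BAct c\<close>
  becomes the test for letters in the preimage of \<open>c\<close>. This leads from functions on
  states back to the letters of the given alphabet.\<close>

lemma definable_map:
  assumes "definable (g ` A) P" "finite A"
  shows "definable A (\<lambda>w. P (map g w))"
proof -
  have *: "definable A (\<lambda>w. map g w \<in> L_be \<psi>)" for \<psi>
  proof (induction \<psi>)
    case (BAct c)
    show ?case
      by (rule definable_cong[OF definable_subset[OF assms(2), of "g -` {c}"]])
        (auto simp: L_be_BAct)
  next
    case (BNot \<psi>)
    show ?case
      by (rule definable_cong[OF definable_not[OF BNot]]) (auto simp: L_be_BNot)
  next
    case (BAnd \<psi> \<chi>)
    show ?case
      by (rule definable_cong[OF definable_and[OF BAnd]]) (auto simp: L_be_iff)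
  next
    case (BB \<psi>)
    show ?case
      by (rule definable_cong[OF definable_prefix[OF BB]])
        (unfold L_be_BB map_eq_append_conv, blast)
  next
    case (BE \<psi>)
    show ?case
      by (rule definable_cong[OF definable_suffix[OF BE]])
        (unfold L_be_BE map_eq_append_conv, blast)
  qed
  obtain \<psi> where \<psi>: "\<forall>w. w \<noteq> [] \<longrightarrow> set w \<subseteq> g ` A \<longrightarrow> (w \<in> L_be \<psi> \<longleftrightarrow> P w)"
    using assms unfolding definable_def by blast
  show ?thesis
  proof (rule definable_cong[OF *[of \<psi>]])
    fix w assume "w \<noteq> []" "set w \<subseteq> A"
    then have "map g w \<noteq> []" "set (map g w) \<subseteq> g ` A" by auto
    then show "map g w \<in> L_be \<psi> \<longleftrightarrow> P (map g w)" using \<psi> by blast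
  qed
qed

section \<open>The automaton of an LTL formula\<close>

fun subformulas :: "'a ltl \<Rightarrow> 'a ltl set" where
  "subformulas LTrue = {LTrue}"
| "subformulas (LAct a) = {LAct a}"
| "subformulas (LNot \<phi>) = insert (LNot \<phi>) (subformulas \<phi>)"
| "subformulas (LAnd \<phi> \<psi>) = insert (LAnd \<phi> \<psi>) (subformulas \<phi> \<union> subformulas \<psi>)"
| "subformulas (LNext \<phi>) = insert (LNext \<phi>) (subformulas \<phi>)"
| "subformulas (LUntil \<phi> \<psi>) = insert (LUntil \<phi> \<psi>) (subformulas \<phi> \<union> subformulas \<psi>)"

lemma finite_subformulas: "finite (subformulas \<phi>)"
  by (induction \<phi>) auto

lemma subformulas_refl: "\<phi> \<in> subformulas \<phi>"
  by (cases \<phi>) auto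

lemma subformulas_trans: "\<chi> \<in> subformulas \<phi> \<Longrightarrow> subformulas \<chi> \<subseteq> subformulas \<phi>"
  by (induction \<phi>) auto

text \<open>\<open>holds a S \<phi>\<close> is the truth value of \<open>\<phi>\<close> at a position carrying the letter \<open>a\<close>, if \<open>S\<close> is the
  set of formulas true at the next position, or empty if there is no next position.\<close>

fun holds :: "'a \<Rightarrow> 'a ltl set \<Rightarrow> 'a ltl \<Rightarrow> bool" where
  "holds a S LTrue \<longleftrightarrow> True"
| "holds a S (LAct c) \<longleftrightarrow> a = c"
| "holds a S (LNot \<phi>) \<longleftrightarrow> \<not> holds a S \<phi>"
| "holds a S (LAnd \<phi> \<psi>) \<longleftrightarrow> holds a S \<phi> \<and> holds a S \<psi>"
| "holds a S (LNext \<phi>) \<longleftrightarrow> \<phi> \<in> S"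
| "holds a S (LUntil \<phi> \<psi>) \<longleftrightarrow> holds a S \<psi> \<or> (holds a S \<phi> \<and> LUntil \<phi> \<psi> \<in> S)"

text \<open>Restricting to subformulas of \<open>\<phi>\<close> keeps the state set finite. The
  automaton reads from right to left, with \<open>S\<close> the state of the suffix already
  read.\<close>

definition ltl_step :: "'a ltl \<Rightarrow> 'a \<Rightarrow> 'a ltl set \<Rightarrow> 'a ltl set" where
  "ltl_step \<phi> a S = {\<chi> \<in> subformulas \<phi>. holds a S \<chi>}"

section \<open>States of the automaton as sets of true subformulas\<close>

lemma ltl_sat_Cons_Suc: "ltl_sat (a # w) (Suc i) \<phi> \<longleftrightarrow> ltl_sat w i \<phi>"
proof (induction \<phi> arbitrary: i)
  case (LUntil \<phi> \<psi>)
  have "(\<exists>j. Suc i \<le> j \<and> j < length (a # w) \<and> ltl_sat (a # w) j \<psi> \<and>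
      (\<forall>k. Suc i \<le> k \<and> k < j \<longrightarrow> ltl_sat (a # w) k \<phi>)) \<longleftrightarrow>
    (\<exists>j. i \<le> j \<and> j < length w \<and> ltl_sat (a # w) (Suc j) \<psi> \<and>
      (\<forall>k. i \<le> k \<and> k < j \<longrightarrow> ltl_sat (a # w) (Suc k) \<phi>))" (is "?L \<longleftrightarrow> ?R")
  proof
    assume ?L
    then obtain j where j: "Suc i \<le> j" "j < length (a # w)" "ltl_sat (a # w) j \<psi>"
      "\<forall>k. Suc i \<le> k \<and> k < j \<longrightarrow> ltl_sat (a # w) k \<phi>" by blast
    then show ?R by (intro exI[of _ "j - 1"]) (cases j; auto)
  next
    assume ?R
    then obtain j where j: "i \<le> j" "j < length w" "ltl_sat (a # w) (Suc j) \<psi>"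
      "\<forall>k. i \<le> k \<and> k < j \<longrightarrow> ltl_sat (a # w) (Suc k) \<phi>" by blast
    have "ltl_sat (a # w) k \<phi>" if "Suc i \<le> k" "k < Suc j" for k
      using that j(4) by (cases k) auto
    then show ?L using j by (intro exI[of _ "Suc j"]) auto
  qed
  then show ?case by (simp add: LUntil)
qed auto

text \<open>The expansion law of until, matching the recursion in \<open>holds\<close>.\<close>

lemma ltl_sat_Until_Cons:
  "ltl_sat (a # w) 0 (LUntil \<phi> \<psi>) \<longleftrightarrow> ltl_sat (a # w) 0 \<psi> \<or>
     (ltl_sat (a # w) 0 \<phi> \<and> w \<noteq> [] \<and> ltl_sat w 0 (LUntil \<phi> \<psi>))" (is "?L \<longleftrightarrow> ?R")
proof
  assume ?L
  then obtain j where j: "j < length (a # w)" "ltl_sat (a # w) j \<psi>"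
    "\<forall>k. k < j \<longrightarrow> ltl_sat (a # w) k \<phi>" by auto
  show ?R
  proof (cases j)
    case (Suc i)
    have "ltl_sat w k \<phi>" if "k < i" for k
      using j(3)[rule_format, of "Suc k"] that Suc by (simp add: ltl_sat_Cons_Suc)
    moreover have "ltl_sat w i \<psi>" "ltl_sat (a # w) 0 \<phi>" "i < length w"
      using j Suc by (auto simp: ltl_sat_Cons_Suc)
    ultimately have "ltl_sat w i \<psi>" "\<forall>k<i. ltl_sat w k \<phi>" "ltl_sat (a # w) 0 \<phi>" "i < length w"
      by blast+
    then show ?thesis by auto
  qed (use j in auto)
next
  assume ?R
  then show ?L
  proof
    assume "ltl_sat (a # w) 0 \<psi>"
    then show ?L by auto
  next
    assume R: "ltl_sat (a # w) 0 \<phi> \<and> w \<noteq> [] \<and> ltl_sat w 0 (LUntil \<phi> \<psi>)"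
    then obtain j where j: "j < length w" "ltl_sat w j \<psi>" "\<forall>k. k < j \<longrightarrow> ltl_sat w k \<phi>" by auto
    have "ltl_sat (a # w) k \<phi>" if "k < Suc j" for k
      using that j R by (cases k) (auto simp: ltl_sat_Cons_Suc)
    then show ?L using j by (auto intro!: exI[of _ "Suc j"] simp: ltl_sat_Cons_Suc)
  qed
qed

text \<open>Each letter read adds a position on the left. The start state \<open>{}\<close> stands
  for the missing next position: against it a next formula is false and an until formula reduces to
  its second argument.\<close>

lemma run_ltl_step:
  "run (map (ltl_step \<phi>) (rev w)) {} = {\<chi> \<in> subformulas \<phi>. w \<noteq> [] \<and> ltl_sat w 0 \<chi>}"
proof (induction w)
  case (Cons a w)
  let ?S = "{\<chi> \<in> subformulas \<phi>. w \<noteq> [] \<and> ltl_sat w 0 \<chi>}"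
  have "holds a ?S \<chi> \<longleftrightarrow> ltl_sat (a # w) 0 \<chi>" if "\<chi> \<in> subformulas \<phi>" for \<chi>
    using that
  proof (induction \<chi>)
    case (LNot \<chi>)
    then show ?case using subformulas_trans[OF LNot.prems] subformulas_refl[of \<chi>] by auto
  next
    case (LAnd \<chi> \<psi>)
    then show ?case
      using subformulas_trans[OF LAnd.prems] subformulas_refl[of \<chi>] subformulas_refl[of \<psi>] by auto
  next
    case (LNext \<chi>)
    then show ?case
      using subformulas_trans[OF LNext.prems] subformulas_refl[of \<chi>] by (auto simp: ltl_sat_Cons_Suc)
  next
    case (LUntil \<chi> \<psi>)
    then show ?case
      unfolding ltl_sat_Until_Cons
      using subformulas_trans[OF LUntil.prems] subformulas_refl[of \<chi>] subformulas_refl[of \<psi>]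
      by (auto simp del: ltl_sat.simps)
  qed auto
  then show ?case using Cons by (auto simp: ltl_step_def)
qed simp

text \<open>In the case of an until formula, each letter either fixes the truth value or leaves it
  unchanged. Hence if the value agreed with its shift by \<open>m\<close> nowhere, no letter could ever change
  it, and it would be constant.\<close>

lemma ltl_run_periodic:
  fixes s :: "nat \<Rightarrow> 'a ltl set"
  assumes step: "\<And>j. s (Suc j) = ltl_step \<phi> (a j) (s j)"
    and a: "\<And>j. a (j + m) = a j"
    and K: "0 < K" "\<And>j. s (j + K) = s j"
  shows "s (j + m) = s j"
proof -
  \<comment> \<open>Since \<open>s\<close> has period \<open>K\<close>, agreement passes from
    \<open>j + K\<close> to \<open>j\<close>; holding from some point on, it then holds
    everywhere.\<close>
  have backward: "\<forall>j. R j" if R: "\<And>j. R (j + K) \<Longrightarrow> R j" and k: "\<And>j. k \<le> j \<Longrightarrow> R j"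
    for R :: "nat \<Rightarrow> bool" and k :: nat
  proof
    fix j
    have "R (j + i * K) \<Longrightarrow> R j" for i
    proof (induction i)
      case (Suc i)
      then have "R ((j + i * K) + K)" by (simp add: algebra_simps)
      then show ?case using Suc.IH R by blast
    qed simp
    moreover have "k \<le> j + k * K" using K(1) by (simp add: trans_le_add2)
    ultimately show "R j" using k by blast
  qed
  have per: "\<chi> \<in> s (j + K + m) \<longleftrightarrow> \<chi> \<in> s (j + m)" "\<chi> \<in> s (j + K) \<longleftrightarrow> \<chi> \<in> s j" for \<chi> j
    using K(2)[of "j + m"] K(2)[of j] by (auto simp: ac_simps)
  have "\<forall>j. \<chi> \<in> s (j + m) \<longleftrightarrow> \<chi> \<in> s j" if "\<chi> \<in> subformulas \<phi>" for \<chi>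
    using that
  proof (induction \<chi>)
    case (LUntil \<chi> \<psi>)
    let ?U = "LUntil \<chi> \<psi>"
    have sub: "\<chi> \<in> subformulas \<phi>" "\<psi> \<in> subformulas \<phi>"
      using subformulas_trans[OF LUntil.prems] subformulas_refl[of \<chi>] subformulas_refl[of \<psi>] by auto
    have rec: "?U \<in> s (Suc j) \<longleftrightarrow> \<psi> \<in> s (Suc j) \<or> (\<chi> \<in> s (Suc j) \<and> ?U \<in> s j)" for j
      using LUntil.prems sub by (auto simp: step ltl_step_def)
    have \<chi>\<psi>: "\<chi> \<in> s (Suc (j + m)) \<longleftrightarrow> \<chi> \<in> s (Suc j)" "\<psi> \<in> s (Suc (j + m)) \<longleftrightarrow> \<psi> \<in> s (Suc j)" for j
      using LUntil.IH(1)[OF sub(1), rule_format, of "Suc j"]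
        LUntil.IH(2)[OF sub(2), rule_format, of "Suc j"] by auto
    let ?R = "\<lambda>j. ?U \<in> s (j + m) \<longleftrightarrow> ?U \<in> s j"
    \<comment> \<open>At corresponding positions \<open>\<chi>\<close> and \<open>\<psi>\<close>
      agree by induction, so agreement of the until formula, once reached, persists.\<close>
    have forward: "?R (Suc j)" if "?R j" for j
      using that rec[of j] rec[of "j + m"] \<chi>\<psi>[of j] by simp
    have "\<exists>k. ?R k"
    proof (rule ccontr)
      assume no: "\<not> (\<exists>k. ?R k)"
      have const: "?U \<in> s (Suc j) \<longleftrightarrow> ?U \<in> s j" for j
      proof -
        have "\<not> ?R j" "\<not> ?R (Suc j)" using no by blast+
        then show ?thesis using rec[of j] rec[of "j + m"] \<chi>\<psi>[of j] by auto
      qed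
      have "?U \<in> s j \<longleftrightarrow> ?U \<in> s 0" for j by (induction j) (simp_all add: const)
      then show False using no by blast
    qed
    then obtain k where k: "?R k" by blast
    have "?R j" if "k \<le> j" for j
      using that by (induction j rule: dec_induct) (use k forward in blast)+
    then show ?case using backward[of ?R k] per by blast
  next
    case (LNot \<chi>)
    let ?R = "\<lambda>j. LNot \<chi> \<in> s (j + m) \<longleftrightarrow> LNot \<chi> \<in> s j"
    have sub: "\<chi> \<in> subformulas \<phi>"
      using subformulas_trans[OF LNot.prems] subformulas_refl[of \<chi>] by auto
    have rec: "LNot \<chi> \<in> s (Suc j) \<longleftrightarrow> \<chi> \<notin> s (Suc j)" for j
      using LNot.prems sub by (auto simp: step ltl_step_def)
    \<comment> \<open>The recursion describes only states produced by a step, that is, positions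
      from 1 on; \<open>backward\<close> recovers position 0. The remaining cases proceed
      likewise.\<close>
    have "?R (Suc j)" for j
      using rec[of j] rec[of "j + m"] LNot.IH[OF sub, rule_format, of "Suc j"] by simp
    then have "?R j" if "1 \<le> j" for j
      using that by (metis One_nat_def Suc_le_D)
    then show ?case using backward[of ?R 1] per by blast
  next
    case (LAnd \<chi> \<psi>)
    let ?R = "\<lambda>j. LAnd \<chi> \<psi> \<in> s (j + m) \<longleftrightarrow> LAnd \<chi> \<psi> \<in> s j"
    have sub: "\<chi> \<in> subformulas \<phi>" "\<psi> \<in> subformulas \<phi>"
      using subformulas_trans[OF LAnd.prems] subformulas_refl[of \<chi>] subformulas_refl[of \<psi>] by auto
    have rec: "LAnd \<chi> \<psi> \<in> s (Suc j) \<longleftrightarrow> \<chi> \<in> s (Suc j) \<and> \<psi> \<in> s (Suc j)" for j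
      using LAnd.prems sub by (auto simp: step ltl_step_def)
    have "?R (Suc j)" for j
      using rec[of j] rec[of "j + m"] LAnd.IH(1)[OF sub(1), rule_format, of "Suc j"]
        LAnd.IH(2)[OF sub(2), rule_format, of "Suc j"] by simp
    then have "?R j" if "1 \<le> j" for j
      using that by (metis One_nat_def Suc_le_D)
    then show ?case using backward[of ?R 1] per by blast
  next
    case (LNext \<chi>)
    let ?R = "\<lambda>j. LNext \<chi> \<in> s (j + m) \<longleftrightarrow> LNext \<chi> \<in> s j"
    have sub: "\<chi> \<in> subformulas \<phi>"
      using subformulas_trans[OF LNext.prems] subformulas_refl[of \<chi>] by auto
    have rec: "LNext \<chi> \<in> s (Suc j) \<longleftrightarrow> \<chi> \<in> s j" for j
      using LNext.prems by (auto simp: step ltl_step_def)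
    have "?R (Suc j)" for j
      using rec[of j] rec[of "j + m"] LNext.IH[OF sub, rule_format, of j] by simp
    then have "?R j" if "1 \<le> j" for j
      using that by (metis One_nat_def Suc_le_D)
    then show ?case using backward[of ?R 1] per by blast
  next
    case LTrue
    let ?R = "\<lambda>j. LTrue \<in> s (j + m) \<longleftrightarrow> LTrue \<in> s j"
    have "?R (Suc j)" for j
      using LTrue by (simp add: step ltl_step_def)
    then have "?R j" if "1 \<le> j" for j
      using that by (metis One_nat_def Suc_le_D)
    then show ?case using backward[of ?R 1] per by blast
  next
    case (LAct c)
    let ?R = "\<lambda>j. LAct c \<in> s (j + m) \<longleftrightarrow> LAct c \<in> s j"
    have "?R (Suc j)" for j
      using LAct by (simp add: step ltl_step_def a)
    then have "?R j" if "1 \<le> j" for j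
      using that by (metis One_nat_def Suc_le_D)
    then show ?case using backward[of ?R 1] per by blast
  qed
  moreover have "s j \<subseteq> subformulas \<phi>" for j
  proof -
    \<comment> \<open>Even \<open>s 0\<close> consists of subformulas: by periodicity it equals a
      state that a step has produced.\<close>
    have "s (Suc (j + (K - 1))) \<subseteq> subformulas \<phi>" unfolding step ltl_step_def by blast
    then show ?thesis using K by simp
  qed
  ultimately show ?thesis by blast
qed

text \<open>Repeating the word \<open>n\<close> times leads back to \<open>S\<close>, so the states
  along its infinite repetition have period \<open>n\<close> times its length. Periodicity of the
  letters improves this to the length itself.\<close>

lemma counter_free_ltl_step: "counter_free (Pow (subformulas \<phi>)) (range (ltl_step \<phi>))"
  unfolding counter_free_def
proof (intro allI impI)
  fix v S n
  assume v: "set v \<subseteq> range (ltl_step \<phi>)" and n: "0 < (n::nat)" "(run v ^^ n) S = S"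
  have "v \<in> lists (range (ltl_step \<phi>))" using v by blast
  then obtain w where w: "v = map (ltl_step \<phi>) w" by (auto simp: lists_image)
  show "run v S = S"
  proof (cases "v = []")
    case False
    let ?m = "length w"
    have m: "0 < ?m" using False w by simp
    \<comment> \<open>\<open>a\<close> is the infinite repetition of \<open>w\<close>, and
      \<open>s\<close> lists the states along it, starting in \<open>S\<close>.\<close>
    define a where "a j = w ! (j mod ?m)" for j
    define s where "s j = run (map (\<lambda>i. ltl_step \<phi> (a i)) [0..<j]) S" for j
    have step: "s (Suc j) = ltl_step \<phi> (a j) (s j)" for j by (simp add: s_def)
    have a: "a (j + ?m) = a j" for j by (simp add: a_def)
    have "map (\<lambda>i. ltl_step \<phi> (a i)) [0..<?m] = v"
      unfolding w by (rule nth_equalityI) (auto simp: a_def)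
    then have s_m: "s ?m = run v S" by (simp add: s_def)
    \<comment> \<open>After any number of full copies of \<open>w\<close> the same letters follow as
      at the beginning.\<close>
    have shift: "s (j + ?m * i) = run (map (\<lambda>i. ltl_step \<phi> (a i)) [0..<j]) (s (?m * i))" for i j
      by (induction j) (simp_all add: s_def a_def)
    have "s (?m * i) = (run v ^^ i) S" for i
    proof (induction i)
      case (Suc i)
      have "s (?m * Suc i) = s (?m + ?m * i)" by simp
      also have "\<dots> = run v (s (?m * i))"
        unfolding shift using \<open>map _ _ = v\<close> by simp
      finally show ?case using Suc by simp
    qed (simp add: s_def)
    then have "s (?m * n) = S" using n by simp
    then have "s (j + ?m * n) = s j" for j unfolding shift by (simp add: s_def)
    then have "s (0 + ?m) = s 0"
      using ltl_run_periodic[of s \<phi> a ?m "?m * n" 0] step a m n(1) by simp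
    then show ?thesis using s_m by (simp add: s_def)
  qed simp
qed

theorem theorem4p5:
  fixes \<phi> :: "('a::finite) ltl"
  shows "\<exists>\<psi> :: 'a be. L_be \<psi> = L_ltl \<phi>"
proof -
  let ?Q = "Pow (subformulas \<phi>)"
  have "definable (range (ltl_step \<phi>)) (\<lambda>w. run w {} = q)" for q
    by (rule definable_counter_free[of ?Q])
      (auto simp: finite_subformulas counter_free_ltl_step ltl_step_def)
  \<comment> \<open>Acceptance means that the state reached contains \<open>\<phi>\<close>; there
    are finitely many such states.\<close>
  then have "definable (range (ltl_step \<phi>)) (\<lambda>w. \<exists>q\<in>{q\<in>?Q. \<phi> \<in> q}. run w {} = q)"
    by (intro definable_bex) (auto simp: finite_subformulas)
  \<comment> \<open>\<open>definable_map\<close> replaces the transition functions by letters, and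
    the reversal accounts for reading from right to left.\<close>
  then have "definable UNIV (\<lambda>w. \<exists>q\<in>{q\<in>?Q. \<phi> \<in> q}. run (map (ltl_step \<phi>) (rev w)) {} = q)"
    by (rule definable_rev[OF definable_map]) simp
  then obtain \<psi> where \<psi>: "\<forall>w. w \<noteq> [] \<longrightarrow> (w \<in> L_be \<psi> \<longleftrightarrow>
      (\<exists>q\<in>{q\<in>?Q. \<phi> \<in> q}. run (map (ltl_step \<phi>) (rev w)) {} = q))"
    unfolding definable_def by auto
  have "w \<in> L_be \<psi> \<longleftrightarrow> w \<in> L_ltl \<phi>" for w
  proof (cases "w = []")
    case True
    then show ?thesis using L_be_nonempty by (auto simp: L_ltl_def words_def)
  next
    case False
    then show ?thesis
      using \<psi> by (auto simp: run_ltl_step L_ltl_def words_def subformulas_refl)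
  qed
  then show ?thesis by blast
qed

end
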